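(* For every positive integer $n$, $$\sum_{k=0}^{n-1} q^k \begin{bmatrix} 2k \\ k \end{bmatrix}_q \equiv \left(\frac{n}{3}\right) q^{\frac{n^2-1}{3}} \pmod{\Phi_n(q)^2}.$$
   Context: The Gaussian $q$-binomial coefficient is $\begin{bmatrix} n \\ k \end{bmatrix}_q=\frac{(q;q)_n}{(q;q)_k(q;q)_{n-k}}$ for $0\le k\le n$ and $0$ otherwise, where $(a;q)_m=(1-a)(1-aq)\cdots(1-aq^{m-1})$ for $m\ge1$ and $(a;q)_0=1$. For an integer $m$, $\left(\frac{m}{3}\right)$ is the Legendre symbol modulo 3: $1$ if $m\equiv1\pmod 3$, $-1$ if $m\equiv 2\pmod 3$, $0$ if $3\mid m$ (so the right-hand side is $0$ when $3\mid n$, and otherwise $(n^2-1)/3$ is an integer). $\Phi_n(q)=\prod_{1\le k\le n,\ \gcd(n,k)=1}(q-e^{2\pi i k/n})$ is the $n$th cyclotomic polynomial, and the congruence is divisibility of the difference by $\Phi_n(q)^2$ in $\mathbb{Z}[q]$. *)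

theory Defs
  imports
    Complex_Main
    "HOL-Number_Theory.Number_Theory"
    "HOL-Computational_Algebra.Computational_Algebra"
begin

section \<open>Gaussian binomial coefficients as integer polynomials\<close>

definition qpochhammer :: "'a::comm_ring_1 \<Rightarrow> 'a \<Rightarrow> nat \<Rightarrow> 'a" where
  "qpochhammer a q m = (\<Prod>i<m. 1 - a * q ^ i)"

abbreviation qvar :: "int poly" where
  "qvar \<equiv> [:0, 1:]"

text \<open>The division is the exact one of the integral domain of integer polynomials; the
  divisibility behind it is \<open>qbinomial_mult\<close> below.\<close>

definition qbinomial :: "nat \<Rightarrow> nat \<Rightarrow> int poly" where
  "qbinomial n k =
     (if k \<le> n then qpochhammer qvar qvar n div
                     (qpochhammer qvar qvar k * qpochhammer qvar qvar (n - k))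
      else 0)"

lemma qpochhammer_0 [simp]: "qpochhammer a q 0 = 1"
  by (simp add: qpochhammer_def)

lemma qpochhammer_Suc: "qpochhammer a q (Suc m) = qpochhammer a q m * (1 - a * q ^ m)"
  by (simp add: qpochhammer_def)

lemma qpochhammer_diag_Suc:
  "qpochhammer q q (Suc m) = qpochhammer q q m * (1 - q ^ Suc m)"
  by (simp add: qpochhammer_Suc)

lemma qpochhammer_qvar_nonzero: "qpochhammer qvar qvar m \<noteq> 0"
proof -
  have "1 - qvar * qvar ^ i \<noteq> 0" for i
  proof
    assume "1 - qvar * qvar ^ i = 0"
    hence "poly (1 - qvar * qvar ^ i) 0 = 0" by simp
    thus False by simp
  qed
  thus ?thesis by (simp add: qpochhammer_def)
qed

lemma qpochhammer_dvd:
  fixes q :: "'a::comm_ring_1"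
  shows "qpochhammer q q j * qpochhammer q q k dvd qpochhammer q q (j + k)"
proof (induction "j + k" arbitrary: j k)
  case (Suc n)
  show ?case
  proof (cases "j = 0 \<or> k = 0")
    case False
    then obtain a b where [simp]: "j = Suc a" "k = Suc b"
      by (meson not0_implies_Suc)
    let ?P = "qpochhammer q q"
    have n: "n = a + k" "n = j + b" using Suc.hyps(2) by auto
    have "?P a * ?P k * (1 - q ^ j) dvd ?P n * (1 - q ^ j)"
      using Suc.hyps(1)[OF n(1)] n(1) by (intro mult_dvd_mono) auto
    moreover have "?P a * ?P k * (1 - q ^ j) = ?P j * ?P k"
      by (simp add: qpochhammer_diag_Suc mult_ac del: power_Suc)
    ultimately have 1: "?P j * ?P k dvd ?P n * (1 - q ^ j)" by simp
    have "?P j * ?P b * (1 - q ^ k) dvd ?P n * (1 - q ^ k)"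
      using Suc.hyps(1)[OF n(2)] n(2) by (intro mult_dvd_mono) auto
    moreover have "?P j * ?P b * (1 - q ^ k) = ?P j * ?P k"
      by (simp add: qpochhammer_diag_Suc mult_ac del: power_Suc)
    ultimately have 2: "?P j * ?P k dvd ?P n * (1 - q ^ k)" by simp
    have "?P (j + k) = ?P n * (1 - q ^ (j + k))"
      using Suc.hyps(2) by (metis qpochhammer_diag_Suc)
    also have "\<dots> = ?P n * (1 - q ^ j) + q ^ j * (?P n * (1 - q ^ k))"
      by (simp only: power_add) (simp add: algebra_simps del: power_Suc)
    finally show ?thesis using 1 2 by (metis dvd_add dvd_mult)
  qed auto
qed auto

lemma qbinomial_mult:
  assumes "k \<le> n"
  shows "qbinomial n k * (qpochhammer qvar qvar k * qpochhammer qvar qvar (n - k)) =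
         qpochhammer qvar qvar n"
  using qpochhammer_dvd[of qvar k "n - k"] assms by (simp add: qbinomial_def)


section \<open>Cyclotomic polynomials\<close>

definition cyclotomic_complex :: "nat \<Rightarrow> complex poly" where
  "cyclotomic_complex n =
     (\<Prod>k | 1 \<le> k \<and> k \<le> n \<and> gcd n k = 1.
        [:- exp (2 * of_real pi * \<i> * of_nat k / of_nat n), 1:])"

text \<open>The same polynomial as an element of \<open>int poly\<close>, so that divisibility by it can be taken
  in that ring. That such a (unique) integer polynomial exists is \<open>of_int_cyclotomic\<close> below.\<close>

definition cyclotomic :: "nat \<Rightarrow> int poly" where
  "cyclotomic n = (THE p. map_poly of_int p = cyclotomic_complex n)"

abbreviation (input) of_int_cpoly :: "int poly \<Rightarrow> complex poly" where
  "of_int_cpoly \<equiv> map_poly of_int"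

lemma of_int_cpoly_mult: "of_int_cpoly (p * q) = of_int_cpoly p * of_int_cpoly q"
  by (intro poly_eqI) (simp add: coeff_map_poly coeff_mult)

lemma of_int_cpoly_add: "of_int_cpoly (p + q) = of_int_cpoly p + of_int_cpoly q"
  by (intro poly_eqI) (simp add: coeff_map_poly)

lemma of_int_cpoly_prod: "of_int_cpoly (\<Prod>i\<in>A. f i) = (\<Prod>i\<in>A. of_int_cpoly (f i))"
  by (induction A rule: infinite_finite_induct) (auto simp: of_int_cpoly_mult)

lemma of_int_cpoly_inj: "of_int_cpoly p = of_int_cpoly q \<Longrightarrow> p = q"
  by (simp add: poly_eq_iff coeff_map_poly)

lemma degree_of_int_cpoly: "degree (of_int_cpoly p) = degree p"
  by (rule degree_map_poly) auto

lemma lead_coeff_cyclotomic_complex: "lead_coeff (cyclotomic_complex n) = 1"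
  by (simp add: cyclotomic_complex_def lead_coeff_prod)

lemma unity_root_poly_eq_prod:
  assumes "n > 0"
  shows "(\<Prod>k\<in>{1..n}. [:- exp (2 * of_real pi * \<i> * of_nat k / of_nat n), 1:]) =
         (monom 1 n - 1 :: complex poly)"
proof -
  let ?p = "monom 1 n - 1 :: complex poly"
  let ?e = "\<lambda>k. exp (2 * of_real pi * \<i> * of_nat k / of_nat n) :: complex"
  have cis: "?e k = cis (2 * pi * real k / real n)" for k
    by (simp add: cis_conv_exp mult_ac)
  have e0: "?e n = ?e 0" using assms by (simp add: cis)
  have "rsquarefree ?p"
    unfolding rsquarefree_roots
  proof (intro allI notI, elim conjE)
    fix a assume a: "poly ?p a = 0" "poly (pderiv ?p) a = 0"
    hence "a ^ n = 1" by (simp add: poly_monom)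
    moreover from this have "a \<noteq> 0" using assms by (auto simp: power_0_left)
    ultimately show False
      using a assms by (simp add: pderiv_diff pderiv_monom poly_monom)
  qed
  hence "smult (lead_coeff ?p) (\<Prod>z|poly ?p z = 0. [:-z, 1:]) = ?p"
    by (rule complex_poly_decompose_rsquarefree)
  moreover have "degree ?p = n"
  proof (rule antisym)
    show "degree ?p \<le> n" by (intro degree_diff_le) (auto simp: degree_monom_le)
    show "degree ?p \<ge> n" using assms by (intro le_degree) auto
  qed
  moreover from this have "lead_coeff ?p = 1" using assms by simp
  moreover have "{z. poly ?p z = 0} = {z. z ^ n = 1}" by (simp add: poly_monom)
  ultimately have "?p = (\<Prod>z\<in>{z. z ^ n = 1}. [:-z, 1:])" by simp
  also have "\<dots> = (\<Prod>k<n. [:- ?e k, 1:])"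
    unfolding cis by (rule prod.reindex_bij_betw[OF bij_betw_roots_unity[OF assms], symmetric])
  also have "\<dots> = (\<Prod>k\<in>{1..n}. [:- ?e k, 1:])"
    using e0 assms
    by (intro prod.reindex_bij_witness[of _ "\<lambda>k. if k = n then 0 else k" "\<lambda>k. if k = 0 then n else k"])
       (auto split: if_splits)
  finally show ?thesis ..
qed

lemma prod_cyclotomic_complex:
  assumes "n > 0"
  shows "(\<Prod>d | d dvd n. cyclotomic_complex d) = monom 1 n - 1"
proof -
  let ?f = "\<lambda>n k. [:- exp (2 * of_real pi * \<i> * of_nat k / of_nat n), 1:] :: complex poly"
  let ?A = "\<lambda>d::nat. {k. 1 \<le> k \<and> k \<le> d \<and> gcd d k = 1}"
  have "(\<Prod>d | d dvd n. cyclotomic_complex d) = (\<Prod>(d, k)\<in>(SIGMA d:{d. d dvd n}. ?A d). ?f d k)"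
    unfolding cyclotomic_complex_def using assms by (intro prod.Sigma) auto
  also have "\<dots> = (\<Prod>k\<in>{1..n}. ?f n k)"
  proof (rule prod.reindex_bij_witness[where
      i = "\<lambda>k. (n div gcd n k, k div gcd n k)" and j = "\<lambda>(d, k). k * (n div d)"])
    fix x assume "x \<in> (SIGMA d:{d. d dvd n}. ?A d)"
    then obtain d k where x: "x = (d, k)" "d dvd n" "1 \<le> k" "k \<le> d" "gcd d k = 1" by auto
    then obtain m where m: "n = d * m" by auto
    have pos: "d > 0" "m > 0" using m assms by auto
    have g: "gcd n (k * m) = m"
      using x(5) gcd_mult_distrib_nat[of m d k] by (simp add: m mult.commute)
    show "(\<lambda>k. (n div gcd n k, k div gcd n k)) ((\<lambda>(d, k). k * (n div d)) x) = x"
      using pos g by (simp add: x(1)) (simp add: m)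
    show "(\<lambda>(d, k). k * (n div d)) x \<in> {1..n}"
      using pos x by (simp add: m)
    show "?f n ((\<lambda>(d, k). k * (n div d)) x) = (case x of (d, k) \<Rightarrow> ?f d k)"
      using pos by (simp add: x(1) m field_simps)
  next
    fix k assume k: "k \<in> {1..n}"
    define g where "g = gcd n k"
    have g: "g > 0" using assms by (auto simp: g_def)
    obtain a b where ab: "n = g * a" "k = g * b"
      by (metis g_def gcd_dvd1 gcd_dvd2 dvdE)
    have gg: "gcd (g * a) (g * b) = g" using g_def ab by metis
    have "gcd a b = 1"
      using g g_def ab by (metis gcd_mult_distrib_nat mult_cancel1 mult.right_neutral not_less0)
    thus "(n div gcd n k, k div gcd n k) \<in> (SIGMA d:{d. d dvd n}. ?A d)"
      using k g gg \<open>gcd a b = 1\<close> by (auto simp: ab)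
    show "(\<lambda>(d, k). k * (n div d)) (n div gcd n k, k div gcd n k) = k"
      using k g gg assms by (simp add: ab)
  qed
  also have "\<dots> = monom 1 n - 1" by (rule unity_root_poly_eq_prod[OF assms])
  finally show ?thesis .
qed

lemma cyclotomic_complex_integral:
  assumes "n > 0"
  shows "\<exists>p. of_int_cpoly p = cyclotomic_complex n"
  using assms
proof (induction n rule: less_induct)
  case (less n)
  let ?D = "{d. d dvd n} - {n}"
  have fin: "finite {d. d dvd n}" using less.prems by simp
  have "\<exists>p. of_int_cpoly p = cyclotomic_complex d" if "d \<in> ?D" for d
    using that less.prems by (intro less.IH) (auto dest: dvd_imp_le intro!: le_neq_trans)
  then obtain P where P: "\<And>d. d \<in> ?D \<Longrightarrow> of_int_cpoly (P d) = cyclotomic_complex d"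
    by metis
  define g where "g = (\<Prod>d\<in>?D. P d)"
  have g: "of_int_cpoly g = (\<Prod>d\<in>?D. cyclotomic_complex d)"
    by (simp add: g_def of_int_cpoly_prod P)
  have "lead_coeff (of_int_cpoly g) = 1"
    by (simp only: g lead_coeff_prod lead_coeff_cyclotomic_complex) simp
  hence "(of_int (lead_coeff g) :: complex) = 1"
    by (simp add: degree_of_int_cpoly coeff_map_poly)
  hence lc: "lead_coeff g = 1" by simp
  hence g0: "g \<noteq> 0" by auto
  let ?u = "monom 1 n - 1 :: int poly"
  obtain s r where sr: "pseudo_divmod ?u g = (s, r)" by fastforce
  have u: "?u = g * s + r" and r: "r = 0 \<or> degree r < degree g"
    using pseudo_divmod[OF g0 sr] lc by simp_all
  have "of_int_cpoly ?u = monom 1 n - 1"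
    by (intro poly_eqI) (simp add: coeff_map_poly)
  also have "\<dots> = (\<Prod>d | d dvd n. cyclotomic_complex d)"
    by (simp add: prod_cyclotomic_complex less.prems)
  also have "\<dots> = cyclotomic_complex n * of_int_cpoly g"
    unfolding g using fin by (subst prod.remove[of _ n]) auto
  finally have eq: "of_int_cpoly g * (cyclotomic_complex n - of_int_cpoly s) = of_int_cpoly r"
    by (simp add: u of_int_cpoly_add of_int_cpoly_mult algebra_simps)
  have "cyclotomic_complex n - of_int_cpoly s = 0"
  proof (rule ccontr)
    assume nz: "cyclotomic_complex n - of_int_cpoly s \<noteq> 0"
    have gnz: "of_int_cpoly g \<noteq> 0" using of_int_cpoly_inj[of g 0] g0 by auto
    from eq nz gnz have "of_int_cpoly r \<noteq> 0" by (metis mult_eq_0_iff)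
    hence "degree r < degree g" using r by auto
    moreover have "degree (of_int_cpoly r) \<ge> degree (of_int_cpoly g)"
      unfolding eq[symmetric] using nz gnz by (simp add: degree_mult_eq)
    ultimately show False by (simp add: degree_of_int_cpoly)
  qed
  thus ?case by (intro exI[of _ s]) simp
qed

lemma of_int_cyclotomic:
  assumes "n > 0"
  shows "map_poly of_int (cyclotomic n) = cyclotomic_complex n"
  unfolding cyclotomic_def
proof (rule theI')
  show "\<exists>!p. of_int_cpoly p = cyclotomic_complex n"
    using cyclotomic_complex_integral[OF assms] of_int_cpoly_inj by metis
qed

end

theory Submission
  imports Defs "HOL-Analysis.Complex_Transcendental" "HOL-Library.Nat_Bijection"
begin

text \<open>
  Write \<open>S(e)\<close> for the sum of \<open>q^k [2k, k+e]\<close> over \<open>k < n\<close>. Pascal's rules give a recurrence from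
  \<open>S(e)\<close> to \<open>S(e+3)\<close>, and iterating it from \<open>e = 0\<close> expresses the sum exactly through the
  coefficients \<open>[2n, n+j]\<close> with \<open>j\<close> prime to 3. For \<open>0 < j < n\<close> these vanish at every primitive
  \<open>n\<close>-th root of unity \<open>z\<close>, so the congruence modulo \<open>\<Phi>\<^sub>n\<^sup>2\<close> amounts to a statement about their first
  derivatives at \<open>z\<close>, which are explicit. With \<open>q = z\<^sup>3\<close>, the resulting sum of terms
  \<open>(-1)^m q^(m(m+1)/2) / (1 - q^i)\<close> reduces, by a rational function identity valid for generic \<open>q\<close>, to
  the sum of \<open>1 / (1 - q^k)\<close> over \<open>N < k \<le> n - 1 - N\<close>, where \<open>N = \<lfloor>n/3\<rfloor>\<close>. This range is symmetric under
  \<open>k \<mapsto> n - k\<close>, and \<open>1 / (1 - x) + 1 / (1 - 1/x) = 1\<close> evaluates it. If \<open>3\<close> divides \<open>n\<close>, the terms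
  cancel in pairs instead.
\<close>

section \<open>A recurrence for sums of central q-binomial coefficients\<close>

(* Otherwise the simplifier turns qvar * p into pCons 0 p, which blocks ring normalisation. *)
declare mult_pCons_left [simp del] mult_pCons_right [simp del]

section \<open>Pascal rules and ratios of neighbouring coefficients\<close>

lemma qbinomial_eq_0 [simp]: "n < k \<Longrightarrow> qbinomial n k = 0"
  by (simp add: qbinomial_def)

lemma qbinomial_self [simp]: "qbinomial n n = 1"
  using qpochhammer_qvar_nonzero by (simp add: qbinomial_def)

text \<open>For \<open>k < n\<close> both sides become \<open>(q;q)_n\<close> after multiplication
  by \<open>(q;q)_k (q;q)_(n-k-1)\<close>. For \<open>k \<ge> n\<close> both vanish, truncated
  subtraction turning the right-hand factor into \<open>1 - q^0\<close>.\<close>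

lemma qbinomial_ratio:
  "(1 - qvar ^ Suc k) * qbinomial n (Suc k) = (1 - qvar ^ (n - k)) * qbinomial n k"
proof (cases "k < n")
  case True
  let ?P = "qpochhammer qvar qvar"
  obtain l where n: "n = Suc (k + l)" using True less_iff_Suc_add by blast
  have "((1 - qvar ^ Suc k) * qbinomial n (Suc k)) * (?P k * ?P l) = ?P n"
    using qbinomial_mult[of "Suc k" n] by (simp add: n qpochhammer_diag_Suc mult_ac del: power_Suc)
  also have "\<dots> = ((1 - qvar ^ Suc l) * qbinomial n k) * (?P k * ?P l)"
    using qbinomial_mult[of k n]
    by (simp add: n Suc_diff_le qpochhammer_diag_Suc mult_ac del: power_Suc)
  finally show ?thesis
    using qpochhammer_qvar_nonzero by (simp add: n Suc_diff_le del: power_Suc)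
qed simp

lemma qbinomial_Suc_Suc:
  "qbinomial (Suc n) (Suc k) = qbinomial n k + qvar ^ Suc k * qbinomial n (Suc k)"
proof (cases "k < n")
  case True
  let ?P = "qpochhammer qvar qvar"
  obtain l where n: "n = Suc (k + l)" using True less_iff_Suc_add by blast
  have 1: "qbinomial n k * (?P (Suc k) * ?P (Suc l)) = ?P n * (1 - qvar ^ Suc k)"
    using qbinomial_mult[of k n] by (simp add: n Suc_diff_le qpochhammer_diag_Suc mult_ac del: power_Suc)
  have 2: "qbinomial n (Suc k) * (?P (Suc k) * ?P (Suc l)) = ?P n * (1 - qvar ^ Suc l)"
    using qbinomial_mult[of "Suc k" n] by (simp add: n qpochhammer_diag_Suc mult_ac del: power_Suc)
  have "(qbinomial n k + qvar ^ Suc k * qbinomial n (Suc k)) * (?P (Suc k) * ?P (Suc l)) =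
      ?P n * (1 - qvar ^ Suc k) + qvar ^ Suc k * (?P n * (1 - qvar ^ Suc l))"
    by (simp only: distrib_right 1 mult.assoc 2)
  also have "\<dots> = ?P n * (1 - qvar ^ (Suc k + Suc l))"
    by (simp add: power_add algebra_simps)
  also have "\<dots> = ?P (Suc n)"
    by (simp add: qpochhammer_diag_Suc n del: power_Suc)
  also have "\<dots> = qbinomial (Suc n) (Suc k) * (?P (Suc k) * ?P (Suc l))"
    using qbinomial_mult[of "Suc k" "Suc n"] by (simp add: n)
  finally show ?thesis using qpochhammer_qvar_nonzero by simp
qed (cases "k = n"; simp)

lemma qbinomial_Suc_Suc':
  "qbinomial (Suc n) (Suc k) = qbinomial n (Suc k) + qvar ^ (n - k) * qbinomial n k"
proof (cases "k < n")
  case True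
  from qbinomial_ratio[of k n] show ?thesis
    unfolding qbinomial_Suc_Suc by (simp add: algebra_simps del: power_Suc)
qed (cases "k = n"; simp)

text \<open>The second Pascal rule is applied once, then the first rule to both resulting
  coefficients; \<open>k \<le> n\<close> merges \<open>q^(n-k) q^(k+1)\<close> into
  \<open>q^(n+1)\<close>.\<close>

lemma qbinomial_Suc_Suc_Suc:
  assumes "k \<le> n"
  shows "qbinomial (Suc (Suc n)) (Suc (Suc k)) =
    qvar ^ (k + 2) * qbinomial n (k + 2) + (1 + qvar ^ Suc n) * qbinomial n (Suc k)
    + qvar ^ (n - k) * qbinomial n k"
proof -
  have "qvar ^ (n - k) * qvar ^ Suc k = qvar ^ Suc n"
    using assms by (simp only: power_add[symmetric]) simp
  hence *: "qvar ^ (n - k) * (qvar ^ Suc k * x) = qvar ^ Suc n * x" for x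
    by (metis mult.assoc)
  show ?thesis
    by (subst qbinomial_Suc_Suc', subst (1 2) qbinomial_Suc_Suc)
       (simp only: diff_Suc_Suc * ring_distribs numeral_2_eq_2 add_Suc_right
          add_0_right add_0_left add_ac mult_1_left)
qed

section \<open>The recurrence in the shift \<open>e\<close>\<close>

definition qsum :: "nat \<Rightarrow> nat \<Rightarrow> int poly" where
  "qsum n e = (\<Sum>k<n. qvar ^ k * qbinomial (2 * k) (k + e))"

text \<open>Here \<open>x = q^e\<close>, \<open>y = q^s\<close> with \<open>n = e + s + 1\<close>,
  and \<open>b i\<close> stands for \<open>[2n, n+e+i]\<close>; the abstract form lets ring
  normalisation work. The sides differ by a multiple of the ratio relation between \<open>b1\<close>
  and \<open>b2\<close>.\<close>

lemma qsum_step_identity: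
  fixes q x y b0 b1 b2 b3 :: "'a::idom"
  assumes "(1 - q\<^sup>2 * q * x * y * x) * b2 = (1 - y) * b1"
  shows "q * x * y * b0 + x * b1 +
     x ^ 3 * q ^ 3 * (q ^ 4 * x\<^sup>2 * y * b3 + (1 + q ^ 3 * x\<^sup>2 * y\<^sup>2) * b2 + y * b1) =
    x * (q ^ 3 * x\<^sup>2 * y * b2 + (1 + q ^ 3 * x\<^sup>2 * y\<^sup>2) * b1 + q * y * b0) +
     x ^ 3 * q ^ 3 * b2 + x ^ 4 * q ^ 6 * (q * x * y * b3)"
  (is "?l = ?r")
proof -
  have "?l - ?r = q ^ 3 * x ^ 3 * y * ((1 - y) * b1 - (1 - q\<^sup>2 * q * x * y * x) * b2)"
    by (simp add: algebra_simps eval_nat_numeral)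
  thus ?thesis by (simp add: assms)
qed

text \<open>The increment of \<open>qsum_rec\<close> from \<open>n\<close> to \<open>n + 1\<close>,
  with negative terms moved across. For \<open>e < n\<close> everything is reduced to row
  \<open>2n\<close>; for \<open>e = n\<close> only two coefficients survive, both 1; for
  \<open>e > n\<close> all vanish.\<close>

lemma qsum_step:
  "qvar ^ n * qbinomial (2 * n) (n + e) + qvar ^ e * qbinomial (2 * n) (n + e + 1)
     + qvar ^ (3 * e + 3) * qbinomial (2 * n + 2) (n + e + 3) =
   qvar ^ e * qbinomial (2 * n + 2) (n + e + 2)
     + qvar ^ (3 * e + 3) * qbinomial (2 * n) (n + e + 2)
     + qvar ^ (4 * e + 6) * (qvar ^ n * qbinomial (2 * n) (n + e + 3))"
proof (cases "e < n")
  case True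
  then obtain s where n: "n = Suc (e + s)" using less_iff_Suc_add by blast
  define b where "b i = qbinomial (2 * n) (n + e + i)" for i
  define x y :: "int poly" where "x = qvar ^ e" and "y = qvar ^ s"
  have pw: "qvar ^ n = qvar * x * y" by (simp add: n x_def y_def power_add)
  have r: "(1 - qvar ^ (n + e + 2)) * b 2 = (1 - qvar ^ s) * b 1"
    using qbinomial_ratio[of "n + e + 1" "2 * n"] by (simp add: b_def n)
  have 1: "qbinomial (2 * n + 2) (n + e + 2) =
      qvar ^ (n + e + 2) * b 2 + (1 + qvar ^ Suc (2 * n)) * b 1 + qvar ^ Suc s * b 0"
    using qbinomial_Suc_Suc_Suc[of "n + e" "2 * n"] by (simp add: b_def n)
  have 2: "qbinomial (2 * n + 2) (n + e + 3) =
      qvar ^ (n + e + 3) * b 3 + (1 + qvar ^ Suc (2 * n)) * b 2 + qvar ^ s * b 1"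
    using qbinomial_Suc_Suc_Suc[of "n + e + 1" "2 * n"] by (simp add: b_def n numeral_3_eq_3)
  have r': "(1 - qvar ^ 2 * qvar * x * y * x) * b 2 = (1 - y) * b 1"
    using r by (simp add: power_add pw x_def y_def power2_eq_square mult_ac)
  have e: "qvar ^ (n + e + 2) = qvar ^ 3 * x\<^sup>2 * y" "qvar ^ (n + e + 3) = qvar ^ 4 * x\<^sup>2 * y"
    "qvar ^ Suc (2 * n) = qvar ^ 3 * x\<^sup>2 * y\<^sup>2" "qvar ^ Suc s = qvar * y"
    "qvar ^ (3 * e + 3) = x ^ 3 * qvar ^ 3" "qvar ^ (4 * e + 6) = x ^ 4 * qvar ^ 6"
    "qvar ^ e = x" "qvar ^ s = y" "qvar ^ n = qvar * x * y"
    by (simp_all add: n x_def y_def power_add eval_nat_numeral algebra_simps)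
  let ?l = "qvar ^ n * b 0 + qvar ^ e * b 1 + qvar ^ (3 * e + 3) * qbinomial (2 * n + 2) (n + e + 3)"
  let ?r = "qvar ^ e * qbinomial (2 * n + 2) (n + e + 2) + qvar ^ (3 * e + 3) * b 2
    + qvar ^ (4 * e + 6) * (qvar ^ n * b 3)"
  have "?l = ?r"
    unfolding 1 2 e by (rule qsum_step_identity[OF r'])
  thus ?thesis by (simp only: b_def add_0_right)
next
  case False
  show ?thesis
  proof (cases "e = n")
    case True
    have "qbinomial (2 * n) (n + n) = 1" "qbinomial (2 * n + 2) (n + n + 2) = 1"
      by (simp_all only: mult_2 qbinomial_self)
    thus ?thesis unfolding True by simp
  next
    case ne: False
    thus ?thesis using False by simp
  qed
qed

lemma qsum_rec:
  "qsum n e = qvar ^ e * qbinomial (2 * n) (n + e + 1)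
     - qvar ^ (3 * e + 3) * qbinomial (2 * n) (n + e + 2) + qvar ^ (4 * e + 6) * qsum n (e + 3)"
proof (induction n)
  case (Suc n)
  have S: "qsum (Suc n) e' = qsum n e' + qvar ^ n * qbinomial (2 * n) (n + e')" for e'
    by (simp add: qsum_def)
  have shift: "2 * Suc n = 2 * n + 2" "Suc n + e + 1 = n + e + 2" "Suc n + e + 2 = n + e + 3"
    "n + (e + 3) = n + e + 3"
    by simp_all
  have "qvar ^ n * qbinomial (2 * n) (n + e) =
      qvar ^ e * qbinomial (2 * n + 2) (n + e + 2) + qvar ^ (3 * e + 3) * qbinomial (2 * n) (n + e + 2)
     + qvar ^ (4 * e + 6) * (qvar ^ n * qbinomial (2 * n) (n + e + 3))
     - qvar ^ (3 * e + 3) * qbinomial (2 * n + 2) (n + e + 3)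
     - qvar ^ e * qbinomial (2 * n) (n + e + 1)"
    using qsum_step[of n e] by (simp only: eq_diff_eq add_ac)
  thus ?case
    unfolding S shift Suc.IH distrib_left by simp
qed (simp add: qsum_def)

text \<open>\<open>qsum_rec\<close> is applied at \<open>e = 0, 3, ..., 3(M-1)\<close>; its
  prefactors \<open>q^(12m+6)\<close> multiply to \<open>q^(6M^2)\<close>.\<close>

lemma qsum_expand:
  "qsum n 0 = (\<Sum>m<M. qvar ^ (6 * m\<^sup>2 + 3 * m) * qbinomial (2 * n) (n + (3 * m + 1))
      - qvar ^ (6 * m\<^sup>2 + 9 * m + 3) * qbinomial (2 * n) (n + (3 * m + 2)))
    + qvar ^ (6 * M\<^sup>2) * qsum n (3 * M)"
proof (induction M)
  case (Suc M)
  have "qvar ^ (6 * M\<^sup>2) * qsum n (3 * M) =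
     qvar ^ (6 * M\<^sup>2 + 3 * M) * qbinomial (2 * n) (n + (3 * M + 1))
      - qvar ^ (6 * M\<^sup>2 + 9 * M + 3) * qbinomial (2 * n) (n + (3 * M + 2))
      + qvar ^ (6 * (Suc M)\<^sup>2) * qsum n (3 * Suc M)"
    unfolding qsum_rec[of n "3 * M"] distrib_left right_diff_distrib mult.assoc[symmetric]
       power_add[symmetric]
    by (simp add: power2_eq_square algebra_simps del: power_Suc)
  with Suc show ?case by simp
qed simp

lemma qsum_eq:
  assumes "n \<le> 3 * M"
  shows "qsum n 0 = (\<Sum>m<M. qvar ^ (6 * m\<^sup>2 + 3 * m) * qbinomial (2 * n) (n + (3 * m + 1))
      - qvar ^ (6 * m\<^sup>2 + 9 * m + 3) * qbinomial (2 * n) (n + (3 * m + 2)))"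
proof -
  \<comment> \<open>Its terms contain \<open>[2k, k+3M]\<close> with \<open>k < n \<le> 3M\<close>,
    where the lower index exceeds the upper one.\<close>
  have "qsum n (3 * M) = 0" using assms by (simp add: qsum_def)
  thus ?thesis using qsum_expand[of n M] by simp
qed

section \<open>The central coefficient in cancelled form\<close>

lemma qpochhammer_diag_add:
  "qpochhammer q q (n + m) = qpochhammer q q n * (\<Prod>i<m. 1 - q ^ Suc (n + i))"
  by (induction m) (simp_all add: qpochhammer_diag_Suc mult_ac)

text \<open>At a primitive root of order \<open>n = l + 1\<close>, \<open>qbinomial_mult\<close>
  only gives \<open>0 = 0\<close>. Cancelling \<open>(q;q)_n (1 - q^n)\<close>, by means of
  \<open>1 - q^(2n) = (1 + q^n)(1 - q^n)\<close>, leaves a relation that determines the value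
  there.\<close>

lemma qbinomial_central_mult:
  "qbinomial (2 * Suc l) (Suc l) * qpochhammer qvar qvar l =
   (1 + qvar ^ Suc l) * (\<Prod>i<l. 1 - qvar ^ Suc (Suc l + i))"
proof -
  let ?P = "qpochhammer qvar qvar" and ?R = "\<Prod>i<l. 1 - qvar ^ Suc (Suc l + i)"
  have "qbinomial (2 * Suc l) (Suc l) * ?P l * (?P (Suc l) * (1 - qvar ^ Suc l)) = ?P (Suc l + Suc l)"
  proof -
    have "Suc l \<le> 2 * Suc l" and minus: "2 * Suc l - Suc l = Suc l" and "2 * Suc l = Suc l + Suc l"
      by simp_all
    thus ?thesis
      using qbinomial_mult[of "Suc l" "2 * Suc l"] unfolding minus
      by (simp only: qpochhammer_diag_Suc[of qvar l] mult_ac)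
  qed
  also have "\<dots> = ?P (Suc l) * (?R * (1 - qvar ^ (Suc l + Suc l)))"
    by (subst qpochhammer_diag_add) (simp del: power_Suc)
  also have "1 - qvar ^ (Suc l + Suc l) = (1 + qvar ^ Suc l) * (1 - qvar ^ Suc l)"
    by (simp only: power_add algebra_simps)
  also have "?P (Suc l) * (?R * ((1 + qvar ^ Suc l) * (1 - qvar ^ Suc l))) =
      (1 + qvar ^ Suc l) * ?R * (?P (Suc l) * (1 - qvar ^ Suc l))"
    by (simp only: mult_ac)
  finally have *: "qbinomial (2 * Suc l) (Suc l) * ?P l * (?P (Suc l) * (1 - qvar ^ Suc l)) =
      (1 + qvar ^ Suc l) * ?R * (?P (Suc l) * (1 - qvar ^ Suc l))" .
  have "?P (Suc l) * (1 - qvar ^ Suc l) \<noteq> 0"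
    using qpochhammer_qvar_nonzero[of "Suc l"] qpochhammer_diag_Suc[of qvar l] by auto
  thus ?thesis by (rule iffD1[OF mult_right_cancel *])
qed

section \<open>A partial theta identity\<close>

lemma two_triangle: "2 * triangle m = m * (m + 1)"
  by (induction m) simp_all

definition theta_term :: "'a::comm_ring_1 \<Rightarrow> nat \<Rightarrow> 'a" where
  "theta_term q m = (-1) ^ m * q ^ triangle m"

lemma theta_term_0 [simp]: "theta_term q 0 = 1"
  by (simp add: theta_term_def)

lemma theta_term_Suc: "theta_term q (Suc m) = - (q ^ Suc m * theta_term q m)"
  by (simp add: theta_term_def power_add mult_ac)

text \<open>The two halves of the sum, \<open>K\<close> and \<open>L\<close>, both satisfy a
  first-order recurrence in \<open>N\<close> with factor \<open>- q^(N+1)\<close>, which is also the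
  factor from \<open>theta_term q N\<close> to the next term. The sums of bare theta terms cancel in
  \<open>K - L\<close> up to their ends.\<close>

lemma theta_term_partial_fractions:
  fixes q :: "'a::field"
  assumes "\<And>k. 0 < k \<Longrightarrow> k \<le> 2 * N \<Longrightarrow> q ^ k \<noteq> 1"
  shows "(\<Sum>m<N. theta_term q m * (1 / (1 - q ^ (N - m)) - 1 / (1 - q ^ (N + 1 + m)))) =
         - theta_term q N * (\<Sum>k\<in>{N<..2 * N}. 1 / (1 - q ^ k))"
  using assms
proof (induction N)
  case (Suc N)
  let ?g = "theta_term q"
  define K where "K N = (\<Sum>m<N. ?g m / (1 - q ^ (N - m)))" for N
  define L where "L N = (\<Sum>m<N. ?g m / (1 - q ^ (N + 1 + m)))" for N
  define T where "T = (\<Sum>k\<in>{N<..2 * N}. 1 / (1 - q ^ k))"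
  define y where "y = q ^ Suc N"
  have nz: "1 - q ^ k \<noteq> 0" if "0 < k" "k \<le> 2 * Suc N" for k
    using Suc.prems[OF that] by simp
  have KL: "(\<Sum>m<N. ?g m * (1 / (1 - q ^ (N - m)) - 1 / (1 - q ^ (N + 1 + m)))) = K N - L N" for N
    by (simp add: K_def L_def right_diff_distrib sum_subtractf)
  have IH: "K N - L N = - ?g N * T"
    using Suc.IH Suc.prems unfolding KL T_def by simp
  \<comment> \<open>This is \<open>1/(1-u) = 1 + u/(1-u)\<close> with \<open>u = q^(N-m)\<close>;
    the product \<open>q^(m+1) u = y\<close> does not depend on \<open>m\<close>.\<close>
  have "?g (Suc m) / (1 - q ^ (N - m)) = ?g (Suc m) - y * (?g m / (1 - q ^ (N - m)))"
    if "m < N" for m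
  proof -
    have "y = q ^ Suc m * q ^ (N - m)"
      using that by (simp add: y_def flip: power_add power_Suc)
    thus ?thesis
      using nz[of "N - m"] that by (simp add: theta_term_Suc field_simps)
  qed
  hence K: "K (Suc N) = 1 / (1 - y) + (\<Sum>m<N. ?g (Suc m)) - y * K N"
    unfolding K_def sum.lessThan_Suc_shift sum_distrib_left
    by (simp add: sum_subtractf y_def)
  \<comment> \<open>The same splitting; the power is now \<open>y q^(m+1)\<close>, and its factor
    \<open>q^(m+1)\<close> raises the index of the theta term.\<close>
  have "?g m / (1 - q ^ (Suc N + 1 + m)) = ?g m - y * (?g (Suc m) / (1 - q ^ (N + 1 + Suc m)))"
    if "m < N" for m
  proof -
    have "q ^ (Suc N + 1 + m) = y * q ^ Suc m" "q ^ (N + 1 + Suc m) = y * q ^ Suc m"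
      by (simp_all add: y_def mult_ac power_add)
    moreover have "1 - y * q ^ Suc m \<noteq> 0"
      using nz[of "Suc N + 1 + m"] that calculation(1) by (simp del: power_Suc)
    ultimately show ?thesis
      by (simp only: theta_term_Suc) (simp add: divide_simps, simp add: algebra_simps)
  qed
  hence "L (Suc N) = (\<Sum>m<N. ?g m) - y * (\<Sum>m<N. ?g (Suc m) / (1 - q ^ (N + 1 + Suc m)))
      + ?g N / (1 - q ^ (2 * N + 2))"
    unfolding L_def sum_distrib_left
    by (simp add: sum_subtractf mult_2)
  also have "(\<Sum>m<N. ?g (Suc m) / (1 - q ^ (N + 1 + Suc m))) =
      (\<Sum>m<Suc N. ?g m / (1 - q ^ (N + 1 + m))) - 1 / (1 - y)"
    unfolding sum.lessThan_Suc_shift by (simp add: y_def)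
  also have "(\<Sum>m<Suc N. ?g m / (1 - q ^ (N + 1 + m))) = L N + ?g N / (1 - q ^ (2 * N + 1))"
    by (simp add: L_def mult_2)
  finally have L: "L (Suc N) = (\<Sum>m<N. ?g m)
      - y * (L N + ?g N / (1 - q ^ (2 * N + 1)) - 1 / (1 - y)) + ?g N / (1 - q ^ (2 * N + 2))" .
  have "(\<Sum>m<N. ?g (Suc m)) = (\<Sum>m<N. ?g m) + ?g N - 1"
    using sum.lessThan_Suc_shift[of ?g N] by simp
  hence "K (Suc N) - L (Suc N) = 1 / (1 - y) - y * (1 / (1 - y)) + ?g N - 1 - y * (K N - L N)
      + y * (?g N / (1 - q ^ (2 * N + 1))) - ?g N / (1 - q ^ (2 * N + 2))"
    unfolding K L by (simp add: algebra_simps)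
  also have "1 / (1 - y) - y * (1 / (1 - y)) = 1"
    using nz[of "Suc N"] by (simp add: y_def field_simps)
  also have "1 + ?g N - 1 - y * (K N - L N) + y * (?g N / (1 - q ^ (2 * N + 1)))
        - ?g N / (1 - q ^ (2 * N + 2)) =
      y * ?g N * (T + 1 / (1 - q ^ (2 * N + 1))) + ?g N * (1 - 1 / (1 - q ^ (2 * N + 2)))"
    unfolding IH by (simp add: algebra_simps)
  \<comment> \<open>As \<open>q^(2N+2) = y^2\<close>, this yields both the new end
    \<open>2N+2\<close> of the window of reciprocals and the removal of its old start
    \<open>N+1\<close>.\<close>
  also have "1 - 1 / (1 - q ^ (2 * N + 2)) = y * (1 / (1 - q ^ (2 * N + 2)) - 1 / (1 - y))"
  proof -
    have y2: "q ^ (2 * N + 2) = y * y" by (simp add: y_def mult_2 power_add)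
    have "1 - y \<noteq> 0" "1 - y * y \<noteq> 0"
      using nz[of "Suc N"] nz[of "2 * N + 2"] unfolding y2 by (simp_all add: y_def)
    moreover from this have "1 / (1 - y) = (1 + y) / (1 - y * y)"
      by (simp add: frac_eq_eq algebra_simps)
    moreover have "1 - 1 / (1 - y * y) = y * ((1 - (1 + y)) / (1 - y * y))"
      using \<open>1 - y * y \<noteq> 0\<close> by (simp add: diff_divide_eq_iff)
    ultimately show ?thesis unfolding y2 by (simp only: diff_divide_distrib)
  qed
  also have "y * ?g N * (T + 1 / (1 - q ^ (2 * N + 1))) +
        ?g N * (y * (1 / (1 - q ^ (2 * N + 2)) - 1 / (1 - y))) =
      y * ?g N * (T + 1 / (1 - q ^ (2 * N + 1)) + 1 / (1 - q ^ (2 * N + 2)) - 1 / (1 - y))"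
    by (simp add: algebra_simps)
  also have "T + 1 / (1 - q ^ (2 * N + 1)) + 1 / (1 - q ^ (2 * N + 2)) - 1 / (1 - y) =
      (\<Sum>k\<in>{Suc N<..2 * Suc N}. 1 / (1 - q ^ k))"
  proof -
    have "(\<Sum>k\<in>{N<..2 * Suc N}. 1 / (1 - q ^ k)) = T + 1 / (1 - q ^ (2 * N + 1)) + 1 / (1 - q ^ (2 * N + 2))"
    proof -
      have "{N<..2 * Suc N} = insert (2 * N + 2) (insert (2 * N + 1) {N<..2 * N})" by auto
      thus ?thesis by (simp add: T_def add_ac)
    qed
    moreover have "{N<..2 * Suc N} = insert (Suc N) {Suc N<..2 * Suc N}" by auto
    hence "(\<Sum>k\<in>{N<..2 * Suc N}. 1 / (1 - q ^ k)) =
        1 / (1 - y) + (\<Sum>k\<in>{Suc N<..2 * Suc N}. 1 / (1 - q ^ k))"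
      by (simp add: y_def)
    ultimately show ?thesis by simp
  qed
  also have "y * ?g N = - ?g (Suc N)" by (simp add: theta_term_Suc y_def)
  finally show ?case unfolding KL .
qed simp

text \<open>The sum is added to its own reversal \<open>k \<mapsto> a + b - k\<close>, so each pair
  of inverse powers contributes 1. Doubling also covers a fixed midpoint.\<close>

lemma sum_inverse_reflect:
  fixes q :: "'a::field_char_0"
  assumes "q ^ (a + b) = 1" "\<And>k. a \<le> k \<Longrightarrow> k \<le> b \<Longrightarrow> q ^ k \<noteq> 1"
  shows "2 * (\<Sum>k\<in>{a..b}. 1 / (1 - q ^ k)) = of_nat (Suc b - a)"
proof -
  let ?f = "\<lambda>k. 1 / (1 - q ^ k)"
  have *: "(\<Sum>k\<in>{a..b}. ?f (a + b - k)) = sum ?f {a..b}"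
    by (rule sum.reindex_bij_witness[of _ "\<lambda>k. a + b - k" "\<lambda>k. a + b - k"]) auto
  have "2 * sum ?f {a..b} = (\<Sum>k\<in>{a..b}. ?f k + ?f (a + b - k))"
    by (simp only: sum.distrib mult_2 *)
  also have "\<dots> = (\<Sum>k\<in>{a..b}. 1)"
  proof (rule sum.cong)
    fix k assume k: "k \<in> {a..b}"
    have prod: "q ^ k * q ^ (a + b - k) = 1"
      using assms(1) k by (simp flip: power_add)
    have "q ^ k \<noteq> 1" using assms(2) k by simp
    moreover from this have "q ^ (a + b - k) \<noteq> 1" using prod by auto
    ultimately have "?f k + ?f (a + b - k) =
        ((1 - q ^ (a + b - k)) + (1 - q ^ k)) / ((1 - q ^ k) * (1 - q ^ (a + b - k)))"
      by (subst add_frac_eq) simp_all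
    also have eq: "(1 - q ^ (a + b - k)) + (1 - q ^ k) = (1 - q ^ k) * (1 - q ^ (a + b - k))"
      using prod by (simp add: algebra_simps)
    finally show "?f k + ?f (a + b - k) = 1"
      using \<open>q ^ k \<noteq> 1\<close> \<open>q ^ (a + b - k) \<noteq> 1\<close> by simp
  qed simp
  also have "\<dots> = of_nat (Suc b - a)" by simp
  finally show ?thesis .
qed

text \<open>If \<open>k\<close> is odd then \<open>n\<close> is even, and \<open>z^(n/2)\<close> is
  a square root of 1 other than 1. This supplies the sign when exponents differ by a multiple of
  \<open>n/2\<close>.\<close>

lemma primitive_root_power_half:
  fixes z :: "'a::idom"
  assumes prim: "\<And>m. z ^ m = 1 \<longleftrightarrow> n dvd m" and "n > 0" "even (k * n)"
  shows "z ^ (k * n div 2) = (-1) ^ k"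
proof (cases "even k")
  case True
  then obtain l where "k = 2 * l" by blast
  thus ?thesis using prim[of "l * n"] by simp
next
  case False
  then obtain l where n: "n = 2 * l" using assms(3) by auto
  have "z ^ l \<noteq> 1" unfolding prim using assms(2) n by (auto dest: dvd_imp_le)
  moreover have "(z ^ l)\<^sup>2 = 1"
    using prim[of n] by (simp add: n power_mult[symmetric] mult.commute)
  ultimately have "z ^ l = -1" by (simp add: power2_eq_1_iff)
  moreover have "k * n div 2 = l * k" by (simp add: n)
  ultimately show ?thesis by (simp add: power_mult)
qed

section \<open>Double roots and cyclotomic polynomials\<close>

lemma of_int_cpoly_diff: "of_int_cpoly (p - q) = of_int_cpoly p - of_int_cpoly q"
  by (intro poly_eqI) (simp add: coeff_map_poly)

definition eval_at :: "complex \<Rightarrow> int poly \<Rightarrow> complex" where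
  "eval_at z p = poly (of_int_cpoly p) z"

definition deriv_at :: "complex \<Rightarrow> int poly \<Rightarrow> complex" where
  "deriv_at z p = poly (pderiv (of_int_cpoly p)) z"

lemma eval_at_simps [simp]:
  "eval_at z 0 = 0" "eval_at z 1 = 1" "eval_at z (of_int c) = of_int c" "eval_at z qvar = z"
  "eval_at z (p + q) = eval_at z p + eval_at z q"
  "eval_at z (p - q) = eval_at z p - eval_at z q"
  "eval_at z (p * q) = eval_at z p * eval_at z q"
  by (simp_all add: eval_at_def of_int_cpoly_add of_int_cpoly_diff of_int_cpoly_mult
        map_poly_pCons of_int_poly)

lemma eval_at_power [simp]: "eval_at z (p ^ k) = eval_at z p ^ k"
  by (induction k) simp_all

lemma eval_at_sum [simp]: "eval_at z (\<Sum>i\<in>A. f i) = (\<Sum>i\<in>A. eval_at z (f i))"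
  by (induction A rule: infinite_finite_induct) simp_all

lemma eval_at_prod [simp]: "eval_at z (\<Prod>i\<in>A. f i) = (\<Prod>i\<in>A. eval_at z (f i))"
  by (induction A rule: infinite_finite_induct) simp_all

lemma deriv_at_simps [simp]:
  "deriv_at z 0 = 0" "deriv_at z 1 = 0" "deriv_at z (of_int c) = 0" "deriv_at z qvar = 1"
  "deriv_at z (p + q) = deriv_at z p + deriv_at z q"
  "deriv_at z (p - q) = deriv_at z p - deriv_at z q"
  "deriv_at z (p * q) = deriv_at z p * eval_at z q + eval_at z p * deriv_at z q"
  by (simp_all add: deriv_at_def eval_at_def of_int_cpoly_add of_int_cpoly_diff of_int_cpoly_mult
        map_poly_pCons of_int_poly pderiv_add pderiv_diff pderiv_mult pderiv_pCons)

lemma deriv_at_sum [simp]: "deriv_at z (\<Sum>i\<in>A. f i) = (\<Sum>i\<in>A. deriv_at z (f i))"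
  by (induction A rule: infinite_finite_induct) simp_all

text \<open>The factor \<open>z\<close> avoids the truncated exponent \<open>k - 1\<close>;
  derivatives below are therefore mostly taken times \<open>z\<close>.\<close>

lemma deriv_at_qvar_power: "z * deriv_at z (qvar ^ k) = of_nat k * z ^ k"
  by (induction k) (simp_all add: algebra_simps)

lemma double_root_dvd:
  assumes "eval_at z p = 0" "deriv_at z p = 0"
  shows "[:- z, 1:]\<^sup>2 dvd of_int_cpoly p"
proof -
  obtain r where r: "of_int_cpoly p = [:- z, 1:] * r"
    using assms(1) by (auto simp: eval_at_def poly_eq_0_iff_dvd)
  have "pderiv (of_int_cpoly p) = r + [:- z, 1:] * pderiv r"
    by (simp only: r pderiv_mult) (simp add: pderiv_pCons algebra_simps)
  hence "poly r z = 0"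
    using assms(2) by (simp add: deriv_at_def)
  then obtain s where "r = [:- z, 1:] * s"
    by (auto simp: poly_eq_0_iff_dvd)
  thus ?thesis by (simp add: r power2_eq_square mult.assoc)
qed

text \<open>One squared factor is split off at a time. The other points are distinct from its root,
  so their root orders pass unchanged to the cofactor; hence \<open>p\<close> is arbitrary in the
  induction.\<close>

lemma prod_linear_power2_dvd:
  fixes p :: "complex poly"
  assumes "finite A" "inj_on f A" "\<And>a. a \<in> A \<Longrightarrow> [:- f a, 1:]\<^sup>2 dvd p"
  shows "(\<Prod>a\<in>A. [:- f a, 1:])\<^sup>2 dvd p"
  using assms
proof (induction A arbitrary: p rule: finite_induct)
  case (insert a A)
  obtain r where r: "p = [:- f a, 1:]\<^sup>2 * r" using insert.prems(2)[of a] by blast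
  have "[:- f b, 1:]\<^sup>2 dvd r" if "b \<in> A" for b
  proof (cases "r = 0")
    case False
    have ne: "f b \<noteq> f a" using that insert.prems(1) insert.hyps(2) by (auto simp: inj_on_def)
    hence 0: "order (f b) ([:- f a, 1:]\<^sup>2) = 0"
      by (intro order_0I) simp
    have p: "p \<noteq> 0" using False by (simp add: r)
    have "2 \<le> order (f b) p"
      using insert.prems(2)[of b] that p by (simp add: order_divides)
    also have "\<dots> = order (f b) r"
      using p unfolding r by (simp add: order_mult 0)
    finally show ?thesis using False by (simp add: order_divides)
  qed simp
  hence "(\<Prod>b\<in>A. [:- f b, 1:])\<^sup>2 dvd r"
    using insert.prems(1) by (intro insert.IH) auto
  thus ?case using insert.hyps by (simp add: r power_mult_distrib mult_dvd_mono)
qed simp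

text \<open>Division by a monic polynomial stays in integer polynomials, and a remainder of smaller
  degree that is divisible over the complex numbers must vanish.\<close>

lemma of_int_cpoly_dvd_imp_dvd:
  assumes monic: "lead_coeff g = 1" and dvd: "of_int_cpoly g dvd of_int_cpoly f"
  shows "g dvd f"
proof -
  have g0: "g \<noteq> 0" using monic by auto
  obtain s r where sr: "pseudo_divmod f g = (s, r)" by fastforce
  have f: "f = g * s + r" and r: "r = 0 \<or> degree r < degree g"
    using pseudo_divmod[OF g0 sr] monic by simp_all
  have "of_int_cpoly g dvd of_int_cpoly r"
    using dvd unfolding f of_int_cpoly_add of_int_cpoly_mult by (simp add: dvd_add_right_iff)
  hence "of_int_cpoly r = 0 \<or> degree g \<le> degree r"
    using dvd_imp_degree_le[of "of_int_cpoly g" "of_int_cpoly r"] by (auto simp only: degree_of_int_cpoly)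
  moreover have "r = 0" if "of_int_cpoly r = 0"
    using that by (intro of_int_cpoly_inj) simp
  ultimately have "r = 0" using r by linarith
  thus ?thesis by (simp add: f)
qed

text \<open>Reduces the congruence to a double root at each primitive root. Primitivity is expressed
  by the order property alone, which frees the later computation from exponentials.\<close>

lemma cyclotomic_power2_dvd:
  assumes "n > 0"
    and root: "\<And>z. (\<And>m. z ^ m = 1 \<longleftrightarrow> n dvd m) \<Longrightarrow> eval_at z p = 0 \<and> deriv_at z p = 0"
  shows "(cyclotomic n)\<^sup>2 dvd p"
proof (rule of_int_cpoly_dvd_imp_dvd)
  have oi: "of_int_cpoly (cyclotomic n) = cyclotomic_complex n"
    by (rule of_int_cyclotomic[OF assms(1)])
  have "of_int (lead_coeff (cyclotomic n)) = (1 :: complex)"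
    using lead_coeff_cyclotomic_complex[of n] unfolding oi[symmetric]
    by (simp add: degree_of_int_cpoly coeff_map_poly)
  thus "lead_coeff ((cyclotomic n)\<^sup>2) = 1"
    by (simp add: power2_eq_square lead_coeff_mult)
  let ?A = "{k. 1 \<le> k \<and> k \<le> n \<and> gcd n k = 1}"
  let ?e = "\<lambda>k. exp (2 * of_real pi * \<i> * of_nat k / of_nat n) :: complex"
  have cop: "?e k ^ m = 1 \<longleftrightarrow> n dvd m" if "k \<in> ?A" for k m
  proof -
    have "?e k ^ m = exp (2 * of_real pi * \<i> * of_nat (k * m) / of_nat n)"
      by (simp add: exp_of_nat_mult[symmetric] mult_ac)
    also have "\<dots> = 1 \<longleftrightarrow> n dvd k * m"
      using assms(1) by (intro complex_root_unity_eq_1) simp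
    also have "\<dots> \<longleftrightarrow> n dvd m"
      using that by (intro coprime_dvd_mult_right_iff gcd_eq_1_imp_coprime) blast
    finally show ?thesis .
  qed
  have inj: "inj_on ?e ?A"
  proof (rule inj_onI)
    fix k l assume kl: "k \<in> ?A" "l \<in> ?A" and eq: "?e k = ?e l"
    have n1: "1 \<le> n" using assms(1) by simp
    have "k mod n = l mod n"
      by (rule iffD1[OF complex_root_unity_eq[OF n1] eq])
    \<comment> \<open>Indices run over \<open>1..n\<close> rather than \<open>0..n-1\<close>, so
      only \<open>n\<close> itself is changed by reduction.\<close>
    moreover have "j mod n = (if j = n then 0 else j)" if "j \<in> ?A" for j
      using that by auto
    ultimately show "k = l" using kl by (auto split: if_splits)
  qed
  have "[:- ?e k, 1:]\<^sup>2 dvd of_int_cpoly p" if "k \<in> ?A" for k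
    using root[OF cop[OF that]] by (intro double_root_dvd) (rule conjunct1, assumption, rule conjunct2, assumption)
  hence "(\<Prod>k\<in>?A. [:- ?e k, 1:])\<^sup>2 dvd of_int_cpoly p"
    by (intro prod_linear_power2_dvd inj) (rule finite_subset[of _ "{..n}"], auto)
  thus "of_int_cpoly ((cyclotomic n)\<^sup>2) dvd of_int_cpoly p"
    by (simp add: power2_eq_square of_int_cpoly_mult oi cyclotomic_complex_def)
qed

section \<open>Values and derivatives at a primitive root of unity\<close>

lemma Legendre_3:
  "Legendre (int (3 * N)) 3 = 0" "Legendre (int (3 * N + 1)) 3 = 1"
  "Legendre (int (3 * N + 2)) 3 = -1"
proof -
  show "Legendre (int (3 * N)) 3 = 0" by (simp add: Legendre_def cong_def)
  have "QuadRes 3 (int (3 * N + 1))"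
    unfolding QuadRes_def by (rule exI[of _ 1]) (simp add: cong_def)
  thus "Legendre (int (3 * N + 1)) 3 = 1" by (simp add: Legendre_def cong_def)
  have "y\<^sup>2 mod 3 \<noteq> 2" for y :: int
  proof -
    have "y mod 3 = 0 \<or> y mod 3 = 1 \<or> y mod 3 = 2" by presburger
    moreover have "y\<^sup>2 mod 3 = (y mod 3)\<^sup>2 mod 3" by (simp add: power_mod)
    ultimately show ?thesis by auto
  qed
  moreover have "int (3 * N + 2) mod 3 = 2" by simp
  ultimately have "\<not> QuadRes 3 (int (3 * N + 2))"
    unfolding QuadRes_def cong_def by simp
  thus "Legendre (int (3 * N + 2)) 3 = -1" by (simp add: Legendre_def cong_def)
qed

context
  fixes z :: complex and n :: nat
  assumes prim: "\<And>m. z ^ m = 1 \<longleftrightarrow> n dvd m" and n_pos: "n > 0"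
begin

lemma root_nonzero: "z \<noteq> 0"
  using prim[of n] n_pos by (auto simp: power_0_left)

lemma root_power_ne_1: "0 < m \<Longrightarrow> m < n \<Longrightarrow> z ^ m \<noteq> 1"
  by (auto simp: prim dest: dvd_imp_le)

text \<open>By \<open>z^n = 1\<close> the two products in \<open>qbinomial_central_mult\<close> take
  the same nonzero value \<open>r\<close>, while \<open>1 + z^n = 2\<close>.\<close>

lemma eval_qbinomial_central: "eval_at z (qbinomial (2 * n) n) = 2"
proof -
  obtain l where n: "n = Suc l" using n_pos not0_implies_Suc by blast
  have zn: "z ^ Suc l = 1" using prim[of n] n by simp
  have shift: "z ^ Suc (Suc l + i) = z ^ Suc i" for i
    using zn by (simp add: power_add mult_ac)
  define r where "r = (\<Prod>i<l. 1 - z ^ Suc i)"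
  have "eval_at z (qpochhammer qvar qvar l) = r"
    by (simp add: qpochhammer_def r_def)
  moreover have "eval_at z (\<Prod>i<l. 1 - qvar ^ Suc (Suc l + i)) = r"
    unfolding r_def eval_at_prod eval_at_simps eval_at_power shift by simp
  moreover have "eval_at z (1 + qvar ^ Suc l) = 2"
    by (simp only: eval_at_simps eval_at_power zn) simp
  ultimately have "eval_at z (qbinomial (2 * n) n) * r = 2 * r"
    using arg_cong[OF qbinomial_central_mult[of l], of "eval_at z"]
    unfolding n by (simp only: eval_at_simps(7))
  moreover have "r \<noteq> 0"
    using root_power_ne_1 by (auto simp: r_def n simp del: power_Suc)
  ultimately show ?thesis by simp
qed

text \<open>Differentiate the ratio relation. Since the coefficients beyond the centre vanish at
  \<open>z\<close>, the product rule links their derivatives by a one-term recurrence, started by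
  the central value 2.\<close>

lemma qbinomial_at_root:
  assumes "Suc i < n"
  shows "eval_at z (qbinomial (2 * n) (n + Suc i)) = 0 \<and>
    (1 - z ^ Suc i) * (z ^ Suc (triangle i) * deriv_at z (qbinomial (2 * n) (n + Suc i))) =
      - 2 * of_nat n * (-1) ^ i"
  using assms
proof (induction i)
  case (0)
  let ?b = "\<lambda>i. qbinomial (2 * n) (n + i)"
  have zn: "z ^ n = 1" using prim[of n] by simp
  have rec: "(1 - qvar ^ Suc n) * ?b 1 = (1 - qvar ^ n) * qbinomial (2 * n) n"
    using qbinomial_ratio[of n "2 * n"] by (simp add: mult_2)
  have z1: "z \<noteq> 1" using root_power_ne_1[of 1] 0 by simp
  have "(1 - z ^ Suc n) * eval_at z (?b 1) = 0"
    using arg_cong[OF rec, of "eval_at z"] by (simp add: zn)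
  hence ev: "eval_at z (?b 1) = 0" using zn z1 by simp
  \<comment> \<open>On the left the value of \<open>?b 1\<close> vanishes, on the right
    \<open>1 - z^n\<close> does; only the derivative of \<open>q^n\<close> times the central value
    remains.\<close>
  have "(1 - z ^ Suc n) * deriv_at z (?b 1) = - deriv_at z (qvar ^ n) * 2"
    using arg_cong[OF rec, of "deriv_at z"]
    by (simp only: deriv_at_simps eval_at_simps eval_at_power zn ev eval_qbinomial_central
        mult_zero_right mult_zero_left add_0_left add_0_right diff_self diff_0)
  hence "(1 - z) * (z * deriv_at z (?b 1)) = - (z * deriv_at z (qvar ^ n)) * 2"
    using zn by (simp add: mult_ac)
  thus ?case using ev zn by (simp add: deriv_at_qvar_power)
next
  case (Suc k)
  define i where "i = Suc k"
  let ?b = "\<lambda>i. qbinomial (2 * n) (n + i)"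
  have zn: "z ^ n = 1" using prim[of n] by simp
  have IH: "eval_at z (?b i) = 0"
    "(1 - z ^ i) * (z ^ Suc (triangle k) * deriv_at z (?b i)) = - 2 * of_nat n * (-1) ^ k"
    using Suc unfolding i_def by simp_all
  have rec: "(1 - qvar ^ Suc (n + i)) * ?b (Suc i) = (1 - qvar ^ (n - i)) * ?b i"
    using qbinomial_ratio[of "n + i" "2 * n"] by (simp add: mult_2)
  have zi: "z ^ Suc (n + i) = z ^ Suc i" using zn by (simp add: power_add)
  have ne: "z ^ Suc i \<noteq> 1" using root_power_ne_1[of "Suc i"] Suc.prems by (simp add: i_def)
  have "(1 - z ^ Suc i) * eval_at z (?b (Suc i)) = 0"
    using arg_cong[OF rec, of "eval_at z"] by (simp only: eval_at_simps eval_at_power zi IH mult_zero_right)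
  hence ev: "eval_at z (?b (Suc i)) = 0" using ne by simp
  have "(1 - z ^ Suc i) * deriv_at z (?b (Suc i)) = (1 - z ^ (n - i)) * deriv_at z (?b i)"
    using arg_cong[OF rec, of "deriv_at z"]
    by (simp only: deriv_at_simps eval_at_simps eval_at_power zi IH ev mult_zero_right add_0_left)
  hence "(1 - z ^ Suc i) * (z ^ i * deriv_at z (?b (Suc i))) =
      (z ^ i * (1 - z ^ (n - i))) * deriv_at z (?b i)"
    by (simp only: mult_ac)
  \<comment> \<open>This cancels the denominator of the previous derivative up to sign; the factor
    \<open>z^i\<close> turns \<open>triangle k\<close> into \<open>triangle i\<close>.\<close>
  also have "z ^ i * (1 - z ^ (n - i)) = - (1 - z ^ i)"
    using Suc.prems zn by (simp add: i_def algebra_simps flip: power_add power_Suc)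
  finally have "(1 - z ^ Suc i) * (z ^ i * deriv_at z (?b (Suc i))) * z ^ Suc (triangle k) =
      - ((1 - z ^ i) * (z ^ Suc (triangle k) * deriv_at z (?b i)))"
    by (simp only: mult_ac mult_minus_left mult_minus_right)
  also have "\<dots> = - 2 * of_nat n * (-1) ^ i"
    unfolding IH by (simp add: i_def)
  finally have "(1 - z ^ Suc i) * (z ^ Suc (triangle i) * deriv_at z (?b (Suc i))) =
      - 2 * of_nat n * (-1) ^ i"
    by (simp add: i_def power_add mult_ac)
  thus ?case using ev unfolding i_def by simp
qed

lemma deriv_at_qvar_power_mult:
  "eval_at z p = 0 \<Longrightarrow> deriv_at z (qvar ^ k * p) = z ^ k * deriv_at z p"
  by simp

text \<open>The exponent splits as \<open>triangle (3m) + 3 triangle m\<close>: the first part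
  matches the power in \<open>qbinomial_at_root\<close>, the second gives the theta term in
  \<open>z^3\<close>.\<close>

lemma deriv_term_1:
  assumes "3 * m + 1 < n"
  shows "z * deriv_at z (qvar ^ (6 * m\<^sup>2 + 3 * m) * qbinomial (2 * n) (n + (3 * m + 1))) =
    - 2 * of_nat n * theta_term (z ^ 3) m / (1 - z ^ (3 * m + 1))"
proof -
  let ?b = "qbinomial (2 * n) (n + (3 * m + 1))"
  have ev: "eval_at z ?b = 0" and
    dv: "(1 - z ^ (3 * m + 1)) * (z ^ Suc (triangle (3 * m)) * deriv_at z ?b) =
      - 2 * of_nat n * (-1) ^ (3 * m)"
    using qbinomial_at_root[of "3 * m"] assms by simp_all
  have "2 * (6 * m\<^sup>2 + 3 * m) = 2 * triangle (3 * m) + 3 * (2 * triangle m)"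
    unfolding two_triangle by (simp add: power2_eq_square algebra_simps)
  hence e: "6 * m\<^sup>2 + 3 * m = triangle (3 * m) + 3 * triangle m" by simp
  have "(1 - z ^ (3 * m + 1)) * (z * deriv_at z (qvar ^ (6 * m\<^sup>2 + 3 * m) * ?b)) =
      ((1 - z ^ (3 * m + 1)) * (z ^ Suc (triangle (3 * m)) * deriv_at z ?b)) * (z ^ 3) ^ triangle m"
    unfolding deriv_at_qvar_power_mult[OF ev] e power_mult[symmetric]
    by (simp only: power_add power_Suc mult_ac)
  also have "\<dots> = - 2 * of_nat n * theta_term (z ^ 3) m"
    unfolding dv theta_term_def by (simp add: power_mult)
  finally have "z * deriv_at z (qvar ^ (6 * m\<^sup>2 + 3 * m) * ?b) * (1 - z ^ (3 * m + 1)) =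
      - 2 * of_nat n * theta_term (z ^ 3) m"
    by (simp only: mult.commute)
  moreover have "1 - z ^ (3 * m + 1) \<noteq> 0"
    using root_power_ne_1[of "3 * m + 1"] assms by simp
  ultimately show ?thesis by (intro eq_divide_imp)
qed

text \<open>The same splitting with \<open>triangle (3m+1)\<close> leaves \<open>z^(3m+2)\<close>
  over, which becomes the numerator.\<close>

lemma deriv_term_2:
  assumes "3 * m + 2 < n"
  shows "z * deriv_at z (qvar ^ (6 * m\<^sup>2 + 9 * m + 3) * qbinomial (2 * n) (n + (3 * m + 2))) =
    2 * of_nat n * theta_term (z ^ 3) m * (z ^ (3 * m + 2) / (1 - z ^ (3 * m + 2)))"
proof -
  let ?b = "qbinomial (2 * n) (n + (3 * m + 2))"
  have ev: "eval_at z ?b = 0" and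
    dv: "(1 - z ^ (3 * m + 2)) * (z ^ Suc (triangle (3 * m + 1)) * deriv_at z ?b) =
      - 2 * of_nat n * (-1) ^ (3 * m + 1)"
    using qbinomial_at_root[of "3 * m + 1"] assms by simp_all
  have "2 * (6 * m\<^sup>2 + 9 * m + 3) =
      2 * triangle (3 * m + 1) + 3 * (2 * triangle m) + 2 * (3 * m + 2)"
    unfolding two_triangle by (simp add: power2_eq_square algebra_simps)
  hence e: "6 * m\<^sup>2 + 9 * m + 3 = triangle (3 * m + 1) + 3 * triangle m + (3 * m + 2)" by simp
  have "(1 - z ^ (3 * m + 2)) * (z * deriv_at z (qvar ^ (6 * m\<^sup>2 + 9 * m + 3) * ?b)) =
      ((1 - z ^ (3 * m + 2)) * (z ^ Suc (triangle (3 * m + 1)) * deriv_at z ?b))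
        * (z ^ 3) ^ triangle m * z ^ (3 * m + 2)"
    unfolding deriv_at_qvar_power_mult[OF ev] e power_mult[symmetric]
    by (simp only: power_add power_Suc mult_ac)
  also have "\<dots> = 2 * of_nat n * theta_term (z ^ 3) m * z ^ (3 * m + 2)"
    unfolding dv theta_term_def by (simp add: power_mult)
  finally show ?thesis
    using root_power_ne_1[of "3 * m + 2"] assms
    by (simp add: nonzero_eq_divide_eq mult.commute del: power_Suc deriv_at_simps)
qed

text \<open>The value at \<open>z\<close> of \<open>z / 2n\<close> times the derivative of the first \<open>N\<close> terms in \<open>qsum_eq\<close>.\<close>

definition root_sum :: "nat \<Rightarrow> complex" where
  "root_sum N = (\<Sum>m<N. theta_term (z ^ 3) m *
     (- 1 / (1 - z ^ (3 * m + 1)) - z ^ (3 * m + 2) / (1 - z ^ (3 * m + 2))))"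

text \<open>The bound \<open>3 * N \<le> n\<close> keeps \<open>3m+1\<close> and \<open>3m+2\<close>
  below \<open>n\<close> for \<open>m < N\<close>, the range of
  \<open>qbinomial_at_root\<close>.\<close>

lemma qsum_terms_at_root:
  assumes "3 * N \<le> n"
  defines "f \<equiv> \<lambda>m. qvar ^ (6 * m\<^sup>2 + 3 * m) * qbinomial (2 * n) (n + (3 * m + 1))
      - qvar ^ (6 * m\<^sup>2 + 9 * m + 3) * qbinomial (2 * n) (n + (3 * m + 2))"
  shows "eval_at z (\<Sum>m<N. f m) = 0"
    and "z * deriv_at z (\<Sum>m<N. f m) = 2 * of_nat n * root_sum N"
proof -
  have "eval_at z (f m) = 0" if "m < N" for m
  proof -
    have "Suc (3 * m) < n" "Suc (3 * m + 1) < n" using that assms(1) by linarith+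
    from this[THEN qbinomial_at_root] show ?thesis by (simp add: f_def)
  qed
  thus "eval_at z (\<Sum>m<N. f m) = 0" by simp
  have "z * deriv_at z (f m) = 2 * of_nat n * (theta_term (z ^ 3) m *
      (- 1 / (1 - z ^ (3 * m + 1)) - z ^ (3 * m + 2) / (1 - z ^ (3 * m + 2))))" if "m < N" for m
  proof -
    have "3 * m + 1 < n" "3 * m + 2 < n" using that assms(1) by linarith+
    thus ?thesis
      unfolding f_def deriv_at_simps(6) right_diff_distrib
      by (simp only: deriv_term_1 deriv_term_2) simp
  qed
  thus "z * deriv_at z (\<Sum>m<N. f m) = 2 * of_nat n * root_sum N"
    by (simp add: root_sum_def sum_distrib_left)
qed

section \<open>Evaluation of \<open>root_sum\<close> by the residue of \<open>n\<close> modulo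
  3\<close>

lemma theta_term_cube_root:
  assumes "k = 3 * triangle m + c * n div 2" "even (c * n)"
  shows "theta_term (z ^ 3) m = (-1) ^ (m + c) * z ^ k"
proof -
  have "z ^ k = (z ^ 3) ^ triangle m * (-1) ^ c"
    using primitive_root_power_half[OF prim n_pos assms(2)]
    by (simp add: assms(1) power_add power_mult)
  thus ?thesis by (simp add: theta_term_def power_add mult_ac)
qed

text \<open>\<open>z^3\<close> is again of order \<open>n\<close>, so it meets the nonvanishing
  hypothesis of \<open>theta_term_partial_fractions\<close>.\<close>

lemma power_cube_ne_1:
  assumes "\<not> 3 dvd n" "0 < k" "k < n"
  shows "(z ^ 3) ^ k \<noteq> 1"
proof -
  have "coprime n 3"
    using prime_imp_coprime[of "3::nat" n] assms(1) by (simp add: coprime_commute)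
  hence "n dvd 3 * k \<longleftrightarrow> n dvd k"
    by (rule coprime_dvd_mult_right_iff)
  thus ?thesis
    using assms(2,3) by (auto simp: prim simp flip: power_mult dest: dvd_imp_le)
qed

text \<open>With \<open>q = z^3\<close>, \<open>z^(3m+1)\<close> is the inverse of
  \<open>q^(N-m)\<close> and \<open>z^(3m+2) = q^(N+1+m)\<close>, so the partial theta identity
  applies. Its window \<open>N+1..2N\<close> has end points adding up to \<open>n\<close>.\<close>

lemma root_sum_1:
  assumes n: "n = 3 * N + 1"
  shows "2 * root_sum N = - of_nat N * theta_term (z ^ 3) N"
proof -
  let ?q = "z ^ 3"
  have n3: "\<not> 3 dvd n" unfolding n by presburger
  have q1: "?q ^ k \<noteq> 1" if "0 < k" "k < n" for k
    using power_cube_ne_1[OF n3 that] .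
  have summand: "- 1 / (1 - z ^ (3 * m + 1)) - z ^ (3 * m + 2) / (1 - z ^ (3 * m + 2)) =
      1 / (1 - ?q ^ (N - m)) - 1 / (1 - ?q ^ (N + 1 + m))" if "m < N" for m
  proof -
    define x y where "x = z ^ (3 * m + 1)" and "y = ?q ^ (N - m)"
    have "3 * m + 1 + 3 * (N - m) = n" using that by (simp add: n)
    hence xy: "x * y = 1"
      unfolding x_def y_def power_mult[symmetric] power_add[symmetric] by (simp add: prim)
    have w: "?q ^ (N + 1 + m) = z ^ (3 * m + 2)"
    proof -
      have "3 * (N + 1 + m) = n + (3 * m + 2)" by (simp add: n)
      hence "?q ^ (N + 1 + m) = z ^ (n + (3 * m + 2))" by (simp only: power_mult[symmetric])
      thus ?thesis using prim[of n] by (simp only: power_add) simp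
    qed
    have y: "y \<noteq> 1" unfolding y_def using that by (intro q1) (auto simp: n)
    have "x \<noteq> 1" using xy y by auto
    hence "- 1 / (1 - x) = 1 / (1 - y) - 1"
      using xy y by (simp add: divide_simps) (simp add: algebra_simps)
    moreover have "z ^ (3 * m + 2) \<noteq> 1" using that by (intro root_power_ne_1) (auto simp: n)
    hence "z ^ (3 * m + 2) / (1 - z ^ (3 * m + 2)) = 1 / (1 - z ^ (3 * m + 2)) - 1"
      by (simp add: divide_simps)
    ultimately show ?thesis unfolding x_def[symmetric] y_def[symmetric] w by simp
  qed
  have "root_sum N = (\<Sum>m<N. theta_term ?q m * (1 / (1 - ?q ^ (N - m)) - 1 / (1 - ?q ^ (N + 1 + m))))"
    unfolding root_sum_def using summand by (intro sum.cong) (simp_all only: lessThan_iff)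
  also have "\<dots> = - theta_term ?q N * (\<Sum>k\<in>{N<..2 * N}. 1 / (1 - ?q ^ k))"
    by (rule theta_term_partial_fractions) (rule q1, auto simp: n)
  also have "{N<..2 * N} = {Suc N..2 * N}" by auto
  finally have "2 * root_sum N = - theta_term ?q N * (2 * (\<Sum>k\<in>{Suc N..2 * N}. 1 / (1 - ?q ^ k)))"
    by simp
  also have "2 * (\<Sum>k\<in>{Suc N..2 * N}. 1 / (1 - ?q ^ k)) = of_nat (Suc (2 * N) - Suc N)"
  proof (rule sum_inverse_reflect)
    have "Suc N + 2 * N = n" by (simp add: n)
    thus "?q ^ (Suc N + 2 * N) = 1" by (simp add: prim flip: power_mult)
  qed (rule q1, auto simp: n)
  finally show ?thesis by simp
qed

text \<open>Compared with \<open>root_sum_1\<close> the two kinds of denominators swap roles. The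
  extra term, from \<open>m = N\<close>, extends the window to \<open>N+1..2N+1\<close>, which is
  what makes it symmetric for this \<open>n\<close>.\<close>

lemma root_sum_2:
  assumes n: "n = 3 * N + 2"
  shows "2 * (root_sum N - theta_term (z ^ 3) N / (1 - z ^ (3 * N + 1))) =
    - of_nat (N + 1) * theta_term (z ^ 3) N"
proof -
  let ?q = "z ^ 3"
  have n3: "\<not> 3 dvd n" unfolding n by presburger
  have q1: "?q ^ k \<noteq> 1" if "0 < k" "k < n" for k
    using power_cube_ne_1[OF n3 that] .
  have w: "?q ^ (N + 1 + m) = z ^ (3 * m + 1)" for m
  proof -
    have "3 * (N + 1 + m) = n + (3 * m + 1)" by (simp add: n)
    hence "?q ^ (N + 1 + m) = z ^ (n + (3 * m + 1))" by (simp only: power_mult[symmetric])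
    thus ?thesis using prim[of n] by (simp only: power_add) simp
  qed
  have summand: "- 1 / (1 - z ^ (3 * m + 1)) - z ^ (3 * m + 2) / (1 - z ^ (3 * m + 2)) =
      1 / (1 - ?q ^ (N - m)) - 1 / (1 - ?q ^ (N + 1 + m))" if "m < N" for m
  proof -
    define x y where "x = z ^ (3 * m + 2)" and "y = ?q ^ (N - m)"
    have "3 * m + 2 + 3 * (N - m) = n" using that by (simp add: n)
    hence xy: "x * y = 1"
      unfolding x_def y_def power_mult[symmetric] power_add[symmetric] by (simp add: prim)
    have y: "y \<noteq> 1" unfolding y_def using that by (intro q1) (auto simp: n)
    have "x \<noteq> 1" using xy y by auto
    hence "x / (1 - x) = - 1 / (1 - y)"
      using xy y by (simp add: divide_simps) (simp add: algebra_simps)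
    thus ?thesis unfolding x_def[symmetric] y_def[symmetric] w by simp
  qed
  have "root_sum N = (\<Sum>m<N. theta_term ?q m * (1 / (1 - ?q ^ (N - m)) - 1 / (1 - ?q ^ (N + 1 + m))))"
    unfolding root_sum_def using summand by (intro sum.cong) (simp_all only: lessThan_iff)
  also have "\<dots> = - theta_term ?q N * (\<Sum>k\<in>{N<..2 * N}. 1 / (1 - ?q ^ k))"
    by (rule theta_term_partial_fractions) (rule q1, auto simp: n)
  finally have "root_sum N - theta_term ?q N / (1 - ?q ^ (N + 1 + N)) =
      - theta_term ?q N * ((\<Sum>k\<in>{N<..2 * N}. 1 / (1 - ?q ^ k)) + 1 / (1 - ?q ^ (N + 1 + N)))"
    by (simp add: algebra_simps)
  also have "(\<Sum>k\<in>{N<..2 * N}. 1 / (1 - ?q ^ k)) + 1 / (1 - ?q ^ (N + 1 + N)) =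
      (\<Sum>k\<in>{Suc N..2 * N + 1}. 1 / (1 - ?q ^ k))"
  proof -
    have "{Suc N..2 * N + 1} = insert (N + 1 + N) {N<..2 * N}" by auto
    thus ?thesis by (simp only: sum.insert finite_greaterThanAtMost) simp
  qed
  finally have "2 * (root_sum N - theta_term ?q N / (1 - ?q ^ (N + 1 + N))) =
      - theta_term ?q N * (2 * (\<Sum>k\<in>{Suc N..2 * N + 1}. 1 / (1 - ?q ^ k)))"
    by simp
  also have "2 * (\<Sum>k\<in>{Suc N..2 * N + 1}. 1 / (1 - ?q ^ k)) = of_nat (Suc (2 * N + 1) - Suc N)"
  proof (rule sum_inverse_reflect)
    have "Suc N + (2 * N + 1) = n" by (simp add: n)
    thus "?q ^ (Suc N + (2 * N + 1)) = 1" by (simp add: prim flip: power_mult)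
  qed (rule q1, auto simp: n)
  also have "Suc (2 * N + 1) - Suc N = N + 1" by simp
  finally show ?thesis unfolding w by (simp only: mult_minus_left mult_minus_right mult.commute)
qed

text \<open>The second fraction at \<open>m\<close> cancels the first one at
  \<open>l = N - 1 - m\<close>, because \<open>z^(3m+2) z^(3l+1) = z^n\<close> and the two theta
  terms agree.\<close>

lemma root_sum_0:
  assumes n: "n = 3 * N"
  shows "root_sum N = 0"
proof -
  let ?g = "theta_term (z ^ 3)"
  define f where "f m = ?g m / (1 - z ^ (3 * m + 1))" for m
  have "?g m * (z ^ (3 * m + 2) / (1 - z ^ (3 * m + 2))) = - f (N - 1 - m)" if m: "m < N" for m
  proof -
    define l where "l = N - 1 - m"
    have N: "N = Suc (m + l)" using m by (simp add: l_def)
    have g: "?g m = ?g l"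
    proof -
      have ev: "even ((m + l) * n)" by (auto simp: n N)
      \<comment> \<open>With \<open>n = 3(m+l+1)\<close>,
        \<open>6 triangle l - 6 triangle m = (l - m) n\<close>; adding \<open>2 n m\<close> avoids
        subtraction.\<close>
      have "2 * (3 * triangle l + n * m) = (m + l) * n + 3 * (2 * triangle m)"
        using two_triangle[of l] two_triangle[of m] by (simp add: n N algebra_simps)
      hence "3 * triangle l + n * m = (m + l) * n div 2 + 3 * triangle m"
        using ev by presburger
      hence "z ^ (3 * triangle l) * z ^ (n * m) = z ^ ((m + l) * n div 2) * z ^ (3 * triangle m)"
        by (simp only: power_add[symmetric])
      moreover have "z ^ (n * m) = 1" by (simp add: prim)
      moreover have "z ^ ((m + l) * n div 2) = (-1) ^ (m + l)"
        by (rule primitive_root_power_half[OF prim n_pos ev])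
      ultimately have "z ^ (3 * triangle l) = (-1) ^ (m + l) * z ^ (3 * triangle m)" by simp
      thus ?thesis
        by (simp add: theta_term_def power_mult[symmetric] power_add)
    qed
    define x y where "x = z ^ (3 * m + 2)" and "y = z ^ (3 * l + 1)"
    have "3 * m + 2 + (3 * l + 1) = n" by (simp add: n N)
    hence xy: "x * y = 1"
      unfolding x_def y_def power_add[symmetric] by (simp add: prim)
    have y: "y \<noteq> 1" unfolding y_def by (intro root_power_ne_1) (auto simp: n N)
    have "x \<noteq> 1" using xy y by auto
    hence "x / (1 - x) = - 1 / (1 - y)"
      using xy y by (simp add: divide_simps) (simp add: algebra_simps)
    thus ?thesis
      unfolding f_def l_def[symmetric] x_def[symmetric] y_def[symmetric] g by simp
  qed
  hence "root_sum N = (\<Sum>m<N. f (N - 1 - m) - f m)"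
    unfolding root_sum_def by (intro sum.cong) (simp_all add: f_def algebra_simps)
  also have "\<dots> = 0"
    using sum.nat_diff_reindex[of f N] by (simp add: sum_subtractf)
  finally show ?thesis .
qed

text \<open>If 3 does not divide \<open>n\<close>, the term \<open>m = N\<close> contains
  \<open>[2n, 2n] = 1\<close> with an exponent exceeding \<open>h = (n^2-1)/3\<close> by a multiple
  of \<open>n\<close>. Its value cancels the Legendre term, and the excess in its derivative cancels
  the remaining terms.\<close>

lemma congruence_at_root:
  defines "F \<equiv> qsum n 0 - of_int (Legendre (int n) 3) * qvar ^ ((n\<^sup>2 - 1) div 3)"
  shows "eval_at z F = 0 \<and> deriv_at z F = 0"
proof -
  define f where "f m = qvar ^ (6 * m\<^sup>2 + 3 * m) * qbinomial (2 * n) (n + (3 * m + 1))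
      - qvar ^ (6 * m\<^sup>2 + 9 * m + 3) * qbinomial (2 * n) (n + (3 * m + 2))" for m
  have shift: "z ^ (h + c * n) = z ^ h" for h c
    by (simp only: power_add prim[of "c * n"]) (simp add: prim)
  have "n mod 3 = 0 \<or> n mod 3 = 1 \<or> n mod 3 = 2" by linarith
  moreover have "n = 3 * (n div 3) + n mod 3" by simp
  ultimately obtain N where "n = 3 * N \<or> n = 3 * N + 1 \<or> n = 3 * N + 2"
    by (metis add_0_right)
  hence "eval_at z F = 0 \<and> z * deriv_at z F = 0"
  proof (elim disjE)
    assume n: "n = 3 * N"
    have F: "F = (\<Sum>m<N. f m)"
      unfolding F_def f_def n Legendre_3 by (subst qsum_eq[of _ N]) simp_all
    show ?thesis
      using qsum_terms_at_root[of N] root_sum_0[OF n] unfolding F f_def by (simp add: n)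
  next
    assume n: "n = 3 * N + 1"
    have L: "Legendre (int n) 3 = 1" unfolding n by (rule Legendre_3)
    have "n \<le> 3 * Suc N" by (simp add: n)
    from qsum_eq[OF this] have qsum: "qsum n 0 = (\<Sum>m<N. f m) + f N"
      by (simp only: f_def sum.lessThan_Suc)
    define h where "h = (n\<^sup>2 - 1) div 3"
    have h: "h = 3 * N\<^sup>2 + 2 * N"
      by (simp add: h_def n power2_eq_square algebra_simps)
    have e: "6 * N\<^sup>2 + 3 * N = h + N * n"
      by (simp add: h n power2_eq_square algebra_simps)
    have "f N = qvar ^ (h + N * n)"
    \<comment> \<open>The first coefficient is \<open>[2n, 2n] = 1\<close>, the second
      \<open>[2n, 2n+1] = 0\<close>.\<close>
    proof -
      have "n + (3 * N + 1) = 2 * n" by (simp add: n)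
      thus ?thesis unfolding f_def e by (simp only:) (simp add: n)
    qed
    hence F: "F = (\<Sum>m<N. f m) + qvar ^ (h + N * n) - qvar ^ h"
      unfolding F_def h_def[symmetric] qsum L by simp
    have ev: "even (N * n)" by (simp add: n)
    hence "2 * h = 2 * (3 * triangle N + N * n div 2)"
      using two_triangle[of N] by (simp add: h n power2_eq_square algebra_simps)
    \<comment> \<open>Here \<open>c = N\<close> in \<open>theta_term_cube_root\<close>, so the sign
      is \<open>(-1)^(2N) = 1\<close>.\<close>
    hence "h = 3 * triangle N + N * n div 2" by (simp only: mult_cancel1) simp
    from theta_term_cube_root[OF this ev] have "theta_term (z ^ 3) N = z ^ h"
      by (simp only: mult_2[symmetric] add.assoc[symmetric]) simp
    hence "of_nat n * (2 * root_sum N) = - (of_nat (N * n) * z ^ h)"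
      unfolding root_sum_1[OF n] by simp
    hence K: "2 * of_nat n * root_sum N = - (of_nat (N * n) * z ^ h)"
      by (simp only: mult.left_commute mult.assoc)
    have le: "3 * N \<le> n" by (simp add: n)
    have S: "eval_at z (\<Sum>m<N. f m) = 0" "z * deriv_at z (\<Sum>m<N. f m) = 2 * of_nat n * root_sum N"
      unfolding f_def by (rule qsum_terms_at_root[OF le])+
    have "z * deriv_at z F = - (of_nat (N * n) * z ^ h) + of_nat (h + N * n) * z ^ h - of_nat h * z ^ h"
      unfolding F deriv_at_simps(5,6) distrib_left right_diff_distrib deriv_at_qvar_power shift S K ..
    hence "z * deriv_at z F = 0" by (simp add: algebra_simps)
    moreover have "eval_at z F = 0"
      unfolding F eval_at_simps eval_at_power shift S by simp
    ultimately show ?thesis by simp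
  next
    assume n: "n = 3 * N + 2"
    have L: "Legendre (int n) 3 = -1" unfolding n by (rule Legendre_3)
    have "n \<le> 3 * Suc N" by (simp add: n)
    from qsum_eq[OF this] have qsum: "qsum n 0 = (\<Sum>m<N. f m) + f N"
      by (simp only: f_def sum.lessThan_Suc)
    define h where "h = (n\<^sup>2 - 1) div 3"
    \<comment> \<open>In this class \<open>m = N\<close> contributes two terms: \<open>t\<close>,
      with coefficient \<open>[2n, 2n-1]\<close>, and the boundary term.\<close>
    define t where "t = qvar ^ (6 * N\<^sup>2 + 3 * N) * qbinomial (2 * n) (n + (3 * N + 1))"
    have h: "h = 3 * N\<^sup>2 + 4 * N + 1"
      by (simp add: h_def n power2_eq_square algebra_simps)
    have e: "6 * N\<^sup>2 + 9 * N + 3 = h + (N + 1) * n"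
      by (simp add: h n power2_eq_square algebra_simps)
    have "f N = t - qvar ^ (h + (N + 1) * n)"
    proof -
      have "n + (3 * N + 2) = 2 * n" by (simp add: n)
      thus ?thesis unfolding f_def e t_def by (simp only: qbinomial_self mult_1_right)
    qed
    hence F: "F = (\<Sum>m<N. f m) + t - qvar ^ (h + (N + 1) * n) + qvar ^ h"
      unfolding F_def h_def[symmetric] qsum L by simp
    have lt: "Suc (3 * N) < n" "3 * N + 1 < n" by (simp_all add: n)
    have t: "eval_at z t = 0"
      "z * deriv_at z t = - 2 * of_nat n * theta_term (z ^ 3) N / (1 - z ^ (3 * N + 1))"
      using qbinomial_at_root[OF lt(1)] deriv_term_1[OF lt(2)] unfolding t_def by simp_all
    have ev: "even ((N + 1) * n)" by (simp add: n)
    hence "2 * h = 2 * (3 * triangle N + (N + 1) * n div 2)"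
      using two_triangle[of N] by (simp add: h n power2_eq_square algebra_simps)
    \<comment> \<open>Now \<open>c = N + 1\<close>, and the sign \<open>(-1)^(2N+1) = -1\<close>
      matches the Legendre symbol.\<close>
    hence "h = 3 * triangle N + (N + 1) * n div 2" by (simp only: mult_cancel1) simp
    from theta_term_cube_root[OF this ev] have "theta_term (z ^ 3) N = - (z ^ h)"
      by (simp only: mult_2[symmetric] add.assoc[symmetric]) simp
    hence "of_nat n * (2 * (root_sum N - theta_term (z ^ 3) N / (1 - z ^ (3 * N + 1)))) =
        of_nat ((N + 1) * n) * z ^ h"
      unfolding root_sum_2[OF n] by (simp add: algebra_simps)
    hence K: "2 * of_nat n * root_sum N + z * deriv_at z t = of_nat ((N + 1) * n) * z ^ h"
      unfolding t by (simp add: algebra_simps)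
    have le: "3 * N \<le> n" by (simp add: n)
    have S: "eval_at z (\<Sum>m<N. f m) = 0" "z * deriv_at z (\<Sum>m<N. f m) = 2 * of_nat n * root_sum N"
      unfolding f_def by (rule qsum_terms_at_root[OF le])+
    have "z * deriv_at z F = of_nat ((N + 1) * n) * z ^ h
        - of_nat (h + (N + 1) * n) * z ^ h + of_nat h * z ^ h"
      unfolding F deriv_at_simps(5,6) distrib_left right_diff_distrib deriv_at_qvar_power shift S K ..
    hence "z * deriv_at z F = 0" by (simp add: algebra_simps)
    moreover have "eval_at z F = 0"
      unfolding F eval_at_simps eval_at_power shift S t by simp
    ultimately show ?thesis by simp
  qed
  thus ?thesis using root_nonzero by simp
qed

end

theorem theorem1p2:
  fixes n :: nat
  assumes "n > 0"
  shows "(cyclotomic n)^2 dvd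
           ((\<Sum>k=0..n-1. qvar ^ k * qbinomial (2 * k) k)
            - of_int (Legendre (int n) 3) * qvar ^ ((n^2 - 1) div 3))"
proof -
  \<comment> \<open>Positivity matters: truncated subtraction would leave the index 0 for
    \<open>n = 0\<close>.\<close>
  have "{0..n-1} = {..<n}" using assms by auto
  hence "(\<Sum>k=0..n-1. qvar ^ k * qbinomial (2 * k) k) = qsum n 0"
    by (simp add: qsum_def)
  thus ?thesis
    using cyclotomic_power2_dvd[OF assms] congruence_at_root[OF _ assms] by simp
qed

end
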